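(* Let $f(x)=\frac{1}{2}x^{\mathsf T} Ax+ b^{\mathsf T} x +c \in \mathbb{R}[x_1,\dots,x_n]_{\le 2}$, where $A$ is a real symmetric $n\times n$ matrix, $b\in\mathbb{R}^n$ and $c\in\mathbb{R}$. The following are equivalent: (a) $f$ is g-convex with respect to some connection on $\mathbb{R}^n$. (b) $f$ is g-convex with respect to (the Levi-Civita connection of) some pseudo-Riemannian metric on $\mathbb{R}^n$. (c) Either $A$ is positive semidefinite or $\operatorname{rank}\left(\begin{bmatrix} A & b\end{bmatrix}\right) > \operatorname{rank}(A)$.
   Context: $\mathbb{R}[x_1,\dots,x_n]_{\le 2}$ is the space of real polynomials of degree at most $2$. A connection means a smooth torsion-free affine connection $\nabla$ ($\nabla_XY-\nabla_YX=[X,Y]$). A smooth function $f$ on a manifold $\mathcal{M}$ is g-convex with respect to $\nabla$ if $f\circ\gamma:[0,1]\to\mathbb{R}$ is convex for every $\nabla$-geodesic $\gamma:[0,1]\to\mathcal{M}$; equivalently, $\mathrm{Hess}_\nabla f(X,Y)=X(Y(f))-(\nabla_XY)(f)$ is positive semidefinite at every point. *)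

theory Defs
  imports "HOL-Analysis.Analysis"
begin

primrec times_cont_diff :: "nat \<Rightarrow> ('a::euclidean_space \<Rightarrow> 'b::real_normed_vector) \<Rightarrow> bool" where
  "times_cont_diff 0 h \<longleftrightarrow> continuous_on UNIV h"
| "times_cont_diff (Suc k) h \<longleftrightarrow> (\<forall>p. h differentiable (at p)) \<and>
     (\<forall>v. times_cont_diff k (\<lambda>p. frechet_derivative h (at p) v))"

definition smooth :: "('a::euclidean_space \<Rightarrow> 'b::real_normed_vector) \<Rightarrow> bool" where
  "smooth h \<longleftrightarrow> (\<forall>k. times_cont_diff k h)"

text \<open>The manifold is a Euclidean space, all of whose tangent spaces are identified with the
  space itself. A vector field is thus a function from the space to itself, and the bracket
  satisfies \<open>[X,Y] = dY(X) - dX(Y)\<close>.\<close>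

definition vderiv :: "('a::euclidean_space \<Rightarrow> 'a) \<Rightarrow> ('a \<Rightarrow> 'b::real_normed_vector) \<Rightarrow> 'a \<Rightarrow> 'b" where
  "vderiv X h p = frechet_derivative h (at p) (X p)"

definition lie_bracket :: "('a::euclidean_space \<Rightarrow> 'a) \<Rightarrow> ('a \<Rightarrow> 'a) \<Rightarrow> 'a \<Rightarrow> 'a" where
  "lie_bracket X Y p = vderiv X Y p - vderiv Y X p"

text \<open>Smooth affine connections, as operators on smooth vector fields; the values of \<open>D\<close> on
  fields that are not smooth are irrelevant. Homogeneity over \<open>\<real>\<close> in the second argument is
  the Leibniz rule for constant \<open>h\<close>.\<close>

definition affine_connection ::
    "(('a::euclidean_space \<Rightarrow> 'a) \<Rightarrow> ('a \<Rightarrow> 'a) \<Rightarrow> ('a \<Rightarrow> 'a)) \<Rightarrow> bool" where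
  "affine_connection D \<longleftrightarrow>
     (\<forall>X Y. smooth X \<longrightarrow> smooth Y \<longrightarrow> smooth (D X Y)) \<and>
     (\<forall>X Y Z. smooth X \<longrightarrow> smooth Y \<longrightarrow> smooth Z \<longrightarrow>
        D (\<lambda>p. X p + Y p) Z = (\<lambda>p. D X Z p + D Y Z p)) \<and>
     (\<forall>(h::'a \<Rightarrow> real) X Z. smooth h \<longrightarrow> smooth X \<longrightarrow> smooth Z \<longrightarrow>
        D (\<lambda>p. h p *\<^sub>R X p) Z = (\<lambda>p. h p *\<^sub>R D X Z p)) \<and>
     (\<forall>X Y Z. smooth X \<longrightarrow> smooth Y \<longrightarrow> smooth Z \<longrightarrow>
        D X (\<lambda>p. Y p + Z p) = (\<lambda>p. D X Y p + D X Z p)) \<and>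
     (\<forall>(h::'a \<Rightarrow> real) X Y. smooth h \<longrightarrow> smooth X \<longrightarrow> smooth Y \<longrightarrow>
        D X (\<lambda>p. h p *\<^sub>R Y p) = (\<lambda>p. vderiv X h p *\<^sub>R Y p + h p *\<^sub>R D X Y p))"

definition torsion_free ::
    "(('a::euclidean_space \<Rightarrow> 'a) \<Rightarrow> ('a \<Rightarrow> 'a) \<Rightarrow> ('a \<Rightarrow> 'a)) \<Rightarrow> bool" where
  "torsion_free D \<longleftrightarrow>
     (\<forall>X Y. smooth X \<longrightarrow> smooth Y \<longrightarrow> (\<lambda>p. D X Y p - D Y X p) = lie_bracket X Y)"

text \<open>\<open>christoffel D p u v\<close> is \<open>D\<^sub>u v\<close> at \<open>p\<close> for constant fields \<open>u\<close>, \<open>v\<close>, that is, the vector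
  with components \<open>\<Sum>i j. \<Gamma>\<^sup>k\<^sub>i\<^sub>j(p) u\<^sub>i v\<^sub>j\<close>.\<close>

definition christoffel ::
    "(('a::euclidean_space \<Rightarrow> 'a) \<Rightarrow> ('a \<Rightarrow> 'a) \<Rightarrow> ('a \<Rightarrow> 'a)) \<Rightarrow> 'a \<Rightarrow> 'a \<Rightarrow> 'a \<Rightarrow> 'a" where
  "christoffel D p u v = D (\<lambda>_. u) (\<lambda>_. v) p"

text \<open>The geodesic equation \<open>\<gamma>'' + \<Gamma>(\<gamma>)(\<gamma>', \<gamma>') = 0\<close> on \<open>[0,1]\<close>, with one-sided derivatives
  at the end points. Twice differentiable solutions are automatically smooth, as \<open>\<Gamma>\<close> is.\<close>

definition geodesic ::
    "(('a::euclidean_space \<Rightarrow> 'a) \<Rightarrow> ('a \<Rightarrow> 'a) \<Rightarrow> ('a \<Rightarrow> 'a)) \<Rightarrow> (real \<Rightarrow> 'a) \<Rightarrow> bool" where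
  "geodesic D \<gamma> \<longleftrightarrow>
     (\<exists>\<gamma>' \<gamma>''. \<forall>t\<in>{0..1}.
        (\<gamma> has_vector_derivative \<gamma>' t) (at t within {0..1}) \<and>
        (\<gamma>' has_vector_derivative \<gamma>'' t) (at t within {0..1}) \<and>
        \<gamma>'' t + christoffel D (\<gamma> t) (\<gamma>' t) (\<gamma>' t) = 0)"

definition g_convex ::
    "(('a::euclidean_space \<Rightarrow> 'a) \<Rightarrow> ('a \<Rightarrow> 'a) \<Rightarrow> ('a \<Rightarrow> 'a)) \<Rightarrow> ('a \<Rightarrow> real) \<Rightarrow> bool" where
  "g_convex D f \<longleftrightarrow> (\<forall>\<gamma>. geodesic D \<gamma> \<longrightarrow> convex_on {0..1} (f \<circ> \<gamma>))"

text \<open>The signature of \<open>g p\<close> is not required to be independent of \<open>p\<close>: this is automatic, because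
  the space is connected.\<close>

definition pseudo_riemannian_metric :: "('a::euclidean_space \<Rightarrow> 'a \<Rightarrow> 'a \<Rightarrow> real) \<Rightarrow> bool" where
  "pseudo_riemannian_metric g \<longleftrightarrow>
     (\<forall>p. bilinear (g p)) \<and>
     (\<forall>p u v. g p u v = g p v u) \<and>
     (\<forall>p u. (\<forall>v. g p u v = 0) \<longrightarrow> u = 0) \<and>
     (\<forall>u v. smooth (\<lambda>p. g p u v))"

definition levi_civita_connection ::
    "('a::euclidean_space \<Rightarrow> 'a \<Rightarrow> 'a \<Rightarrow> real) \<Rightarrow>
     (('a \<Rightarrow> 'a) \<Rightarrow> ('a \<Rightarrow> 'a) \<Rightarrow> ('a \<Rightarrow> 'a)) \<Rightarrow> bool" where
  "levi_civita_connection g D \<longleftrightarrow>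
     affine_connection D \<and> torsion_free D \<and>
     (\<forall>X Y Z. smooth X \<longrightarrow> smooth Y \<longrightarrow> smooth Z \<longrightarrow>
        (\<forall>p. vderiv X (\<lambda>q. g q (Y q) (Z q)) p = g p (D X Y p) (Z p) + g p (Y p) (D X Z p)))"

definition pos_semidef :: "real^'n^'n \<Rightarrow> bool" where
  "pos_semidef A \<longleftrightarrow> (\<forall>x. 0 \<le> x \<bullet> (A *v x))"

definition augmented :: "real^'n^'m \<Rightarrow> real^'m \<Rightarrow> real^('n + unit)^'m" where
  "augmented A b = (\<chi> i j. case j of Inl k \<Rightarrow> A $ i $ k | Inr _ \<Rightarrow> b $ i)"

end

theory Submission
  imports Defs
begin

text \<open>If \<open>b\<close> lies in the range of \<open>A\<close>, then \<open>f\<close> has a critical point, where the Hessian is \<open>A\<close>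
  whatever the connection; testing convexity along the geodesics starting there shows that \<open>A\<close> is
  positive semidefinite. If \<open>b\<close> does not lie in the range, there is \<open>w\<close> with \<open>A w = 0\<close> and
  \<open>b \<bullet> w = 1\<close>. The shear \<open>x \<mapsto> x + (\<onehalf> x\<^sup>T A x) w\<close> is then a diffeomorphism which carries \<open>f\<close>
  to an affine function, so that \<open>f\<close> is affine along the geodesics of the pulled back Euclidean
  metric. The choice \<open>w = 0\<close> gives the Euclidean metric itself, which serves the positive
  semidefinite case.\<close>

section \<open>Closure properties of smooth maps\<close>

lemma times_cont_diff_Suc_imp: "times_cont_diff (Suc k) h \<Longrightarrow> times_cont_diff k h"
proof (induction k arbitrary: h)
  case 0
  then show ?case
    by (auto intro!: differentiable_imp_continuous_on simp: differentiable_on_def)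
qed simp

text \<open>Derivatives are unique, so any explicit formula \<open>h'\<close> may replace
  \<open>frechet_derivative h\<close>. Each closure property below feeds a differentiation rule into
  this introduction rule and applies the induction hypothesis to the resulting formula.\<close>

lemma times_cont_diff_SucI:
  assumes "\<And>p. (h has_derivative h' p) (at p)" and "\<And>v. times_cont_diff k (\<lambda>p. h' p v)"
  shows "times_cont_diff (Suc k) h"
proof -
  have "frechet_derivative h (at p) = h' p" for p
    using frechet_derivative_at[OF assms(1)] by simp
  with assms show ?thesis by (auto simp: differentiable_def)
qed

lemma times_cont_diff_has_derivative:
  "times_cont_diff (Suc k) h \<Longrightarrow> (h has_derivative frechet_derivative h (at p)) (at p)"
  by (simp flip: frechet_derivative_works)

lemma times_cont_diff_const: "times_cont_diff k (\<lambda>_. c)"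
proof (induction k arbitrary: c)
  case (Suc k)
  show ?case by (rule times_cont_diff_SucI[OF has_derivative_const Suc])
qed simp

lemma times_cont_diff_add:
  "times_cont_diff k f \<Longrightarrow> times_cont_diff k g \<Longrightarrow> times_cont_diff k (\<lambda>p. f p + g p)"
proof (induction k arbitrary: f g)
  case (Suc k)
  show ?case
    by (rule times_cont_diff_SucI[OF has_derivative_add[OF times_cont_diff_has_derivative[OF Suc.prems(1)]
            times_cont_diff_has_derivative[OF Suc.prems(2)]]])
       (use Suc in auto)
qed (auto intro: continuous_intros)

lemma times_cont_diff_bounded_linear:
  assumes "bounded_linear L"
  shows "times_cont_diff k f \<Longrightarrow> times_cont_diff k (\<lambda>p. L (f p))"
proof (induction k arbitrary: f)
  case 0
  then show ?case by (auto intro: bounded_linear.continuous_on[OF assms])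
next
  case (Suc k)
  show ?case
    by (rule times_cont_diff_SucI[OF bounded_linear.has_derivative[OF assms
            times_cont_diff_has_derivative[OF Suc.prems]]])
       (use Suc in auto)
qed

text \<open>With a linear inner map the chain rule differentiates \<open>f\<close> in the direction
  \<open>L v\<close>, which is the same at every point. The derivative is therefore again a
  directional derivative of \<open>f\<close> composed with \<open>L\<close>, and the induction goes
  through.\<close>

lemma times_cont_diff_compose_linear:
  fixes f :: "'a::euclidean_space \<Rightarrow> 'b::real_normed_vector"
    and L :: "'c::euclidean_space \<Rightarrow> 'a"
  assumes "bounded_linear L"
  shows "times_cont_diff k f \<Longrightarrow> times_cont_diff k (\<lambda>p. f (L p))"
proof (induction k arbitrary: f)
  case 0
  then show ?case
    by (auto intro: continuous_on_compose2[of UNIV f] linear_continuous_on assms)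
next
  case (Suc k)
  show ?case
    by (rule times_cont_diff_SucI[OF has_derivative_compose[OF bounded_linear_imp_has_derivative[OF assms]
            times_cont_diff_has_derivative[OF Suc.prems]]])
       (use Suc in auto)
qed

text \<open>Each summand of the product rule pairs a derivative of one factor with the other factor
  itself, so the induction step also needs both factors at the lower order \<open>k\<close>.\<close>

lemma times_cont_diff_bilinear:
  fixes f :: "'a::euclidean_space \<Rightarrow> 'b::real_normed_vector"
    and g :: "'a \<Rightarrow> 'c::real_normed_vector"
  assumes "bounded_bilinear B"
  shows "times_cont_diff k f \<Longrightarrow> times_cont_diff k g \<Longrightarrow> times_cont_diff k (\<lambda>p. B (f p) (g p))"
proof (induction k arbitrary: f g)
  case 0
  then show ?case by (auto intro: bounded_bilinear.continuous_on[OF assms])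
next
  case (Suc k)
  have "times_cont_diff k f" "times_cont_diff k g"
    using Suc.prems times_cont_diff_Suc_imp by blast+
  then show ?case
    by (intro times_cont_diff_SucI[OF bounded_bilinear.FDERIV[OF assms
            times_cont_diff_has_derivative[OF Suc.prems(1)] times_cont_diff_has_derivative[OF Suc.prems(2)]]])
       (use Suc in \<open>auto intro!: times_cont_diff_add\<close>)
qed

lemma smooth_const: "smooth (\<lambda>_. c)"
  and smooth_add: "smooth f \<Longrightarrow> smooth g \<Longrightarrow> smooth (\<lambda>p. f p + g p)"
  and smooth_bounded_linear: "bounded_linear L \<Longrightarrow> smooth f \<Longrightarrow> smooth (\<lambda>p. L (f p))"
  and smooth_compose_linear: "bounded_linear L' \<Longrightarrow> smooth h \<Longrightarrow> smooth (\<lambda>p. h (L' p))"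
  and smooth_bilinear: "bounded_bilinear B \<Longrightarrow> smooth f \<Longrightarrow> smooth g' \<Longrightarrow> smooth (\<lambda>p. B (f p) (g' p))"
  by (auto simp: smooth_def times_cont_diff_const times_cont_diff_add
      times_cont_diff_bounded_linear times_cont_diff_compose_linear times_cont_diff_bilinear)

lemmas smooth_inner = smooth_bilinear[OF bounded_bilinear_inner]
lemmas smooth_scaleR = smooth_bilinear[OF bounded_bilinear_scaleR]

lemma smooth_sum: "finite I \<Longrightarrow> (\<And>i. i \<in> I \<Longrightarrow> smooth (h i)) \<Longrightarrow> smooth (\<lambda>p. \<Sum>i\<in>I. h i p)"
  by (induction I rule: finite_induct) (auto intro: smooth_const smooth_add)

lemma smooth_has_derivative: "smooth h \<Longrightarrow> (h has_derivative frechet_derivative h (at p)) (at p)"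
  unfolding smooth_def using times_cont_diff_has_derivative by blast

lemma smooth_imp_continuous_on: "smooth h \<Longrightarrow> continuous_on S h"
  unfolding smooth_def using times_cont_diff.simps(1) continuous_on_subset by blast

lemma smooth_frechet_derivative: "smooth h \<Longrightarrow> smooth (\<lambda>p. frechet_derivative h (at p) v)"
  unfolding smooth_def by (metis times_cont_diff.simps(2))

lemma smooth_linear: "linear L \<Longrightarrow> smooth L" for L :: "'a::euclidean_space \<Rightarrow> 'b::real_normed_vector"
  unfolding smooth_def
proof
  fix k
  assume L: "linear L"
  show "times_cont_diff k L"
  proof (cases k)
    case 0
    with L show ?thesis by (simp add: linear_continuous_on linear_linear)
  next
    case (Suc m)
    then show ?thesis using L
      by (auto intro!: times_cont_diff_SucI[OF bounded_linear_imp_has_derivative] times_cont_diff_const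
          simp: linear_linear simp del: times_cont_diff.simps)
  qed
qed

lemma linear_apply_Basis:
  fixes x :: "'a::euclidean_space"
  assumes "linear L"
  shows "L x = (\<Sum>i\<in>Basis. (x \<bullet> i) *\<^sub>R L i)"
proof -
  have "L x = L (\<Sum>i\<in>Basis. (x \<bullet> i) *\<^sub>R i)" by (simp add: euclidean_representation)
  also have "\<dots> = (\<Sum>i\<in>Basis. (x \<bullet> i) *\<^sub>R L i)"
    using assms by (simp add: linear_sum linear_scale)
  finally show ?thesis .
qed

text \<open>The definition of \<open>smooth\<close> speaks of derivatives in fixed directions only.
  Expanding \<open>X p\<close> in the basis reduces the varying direction to fixed ones with smooth
  coefficients.\<close>

lemma smooth_frechet_derivative_apply:
  fixes h :: "'a::euclidean_space \<Rightarrow> 'b::real_normed_vector"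
  assumes "smooth X" "smooth h"
  shows "smooth (\<lambda>p. frechet_derivative h (at p) (X p))"
proof -
  have "frechet_derivative h (at p) (X p) =
      (\<Sum>i\<in>Basis. (X p \<bullet> i) *\<^sub>R frechet_derivative h (at p) i)" for p
    using has_derivative_linear[OF smooth_has_derivative[OF assms(2)]] by (rule linear_apply_Basis)
  then show ?thesis
    by (simp only:) (intro smooth_sum smooth_scaleR smooth_inner smooth_const
        smooth_frechet_derivative assms finite_Basis)
qed

section \<open>Local existence of geodesics\<close>

text \<open>The partial derivatives are continuous, hence bounded on the compact ball. Their bounds
  add up to a bound on the operator norm, and the mean value inequality on the convex ball gives the
  Lipschitz constant.\<close>

lemma smooth_imp_lipschitz_on_cball:
  fixes F :: "'a::euclidean_space \<Rightarrow> 'b::real_normed_vector"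
  assumes "smooth F"
  shows "\<exists>L. L-lipschitz_on (cball z r) F"
proof -
  have "\<exists>C. \<forall>p\<in>cball z r. norm (frechet_derivative F (at p) i) \<le> C" for i
  proof -
    have "compact ((\<lambda>p. frechet_derivative F (at p) i) ` cball z r)"
      by (intro compact_continuous_image smooth_imp_continuous_on smooth_frechet_derivative assms) simp
    then show ?thesis
      by (auto dest!: compact_imp_bounded simp: bounded_iff)
  qed
  then obtain C where C: "\<And>i p. p \<in> cball z r \<Longrightarrow> norm (frechet_derivative F (at p) i) \<le> C i"
    by metis
  define K where "K = (\<Sum>i\<in>Basis. \<bar>C i\<bar>)"
  have "onorm (frechet_derivative F (at p)) \<le> K" if "p \<in> cball z r" for p
  proof (rule onorm_bound)
    show "0 \<le> K" by (auto simp: K_def intro: sum_nonneg)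
    fix v :: 'a
    have "norm (frechet_derivative F (at p) v) = norm (\<Sum>i\<in>Basis. (v \<bullet> i) *\<^sub>R frechet_derivative F (at p) i)"
      using linear_apply_Basis[OF has_derivative_linear[OF smooth_has_derivative[OF assms]]] by metis
    also have "\<dots> \<le> (\<Sum>i\<in>Basis. norm v * \<bar>C i\<bar>)"
    proof (rule sum_norm_le)
      fix i :: 'a assume "i \<in> Basis"
      then show "norm ((v \<bullet> i) *\<^sub>R frechet_derivative F (at p) i) \<le> norm v * \<bar>C i\<bar>"
        using C[OF that, of i] Basis_le_norm[of i v] by (auto intro!: mult_mono)
    qed
    also have "\<dots> = K * norm v" by (simp add: K_def sum_distrib_left mult.commute)
    finally show "norm (frechet_derivative F (at p) v) \<le> K * norm v" .
  qed
  moreover have "(F has_derivative frechet_derivative F (at p)) (at p within cball z r)" for p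
    using smooth_has_derivative[OF assms] by (rule has_derivative_at_withinI)
  ultimately have "norm (F x - F y) \<le> K * norm (x - y)" if "x \<in> cball z r" "y \<in> cball z r" for x y
    using that by (intro differentiable_bound[of "cball z r"]) auto
  moreover have "0 \<le> K" by (auto simp: K_def intro: sum_nonneg)
  ultimately show ?thesis by (auto simp: lipschitz_on_def dist_norm)
qed

text \<open>Scaling the field by a small \<open>\<epsilon>\<close> makes the Picard operator a contraction over the fixed
  interval \<open>[0,1]\<close>, and keeps its fixed point inside the ball, where truncating the field by the
  nearest-point projection has no effect.\<close>

lemma integral_curve_exists:
  fixes F :: "'a::euclidean_space \<Rightarrow> 'a"
  assumes lip: "L-lipschitz_on (cball z0 r) F" and r: "0 < r"
  obtains \<epsilon> z where "0 < \<epsilon>" and "z 0 = z0"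
    and "\<And>t. t \<in> {0..1} \<Longrightarrow> (z has_vector_derivative \<epsilon> *\<^sub>R F (z t)) (at t within {0..1})"
proof -
  define P where "P = closest_point (cball z0 r)"
  define G where "G x = F (P x)" for x
  have ne: "convex (cball z0 r)" "closed (cball z0 r)" "cball z0 r \<noteq> {}"
    using r by auto
  have Pin: "P x \<in> cball z0 r" for x
    unfolding P_def using closest_point_in_set[OF ne(2,3)] by blast
  have L0: "0 \<le> L" using lip by (rule lipschitz_on_nonneg)
  have G: "dist (G x) (G y) \<le> L * dist x y" for x y
  proof -
    have "dist (G x) (G y) \<le> L * dist (P x) (P y)"
      unfolding G_def using lipschitz_onD[OF lip Pin Pin] .
    also have "\<dots> \<le> L * dist x y"
      unfolding P_def by (intro mult_left_mono closest_point_lipschitz ne L0)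
    finally show ?thesis .
  qed
  then have contG: "continuous_on S G" for S
    by (intro lipschitz_on_continuous_on[of L]) (auto simp: lipschitz_on_def L0)
  define M where "M = norm (F z0) + L * r"
  have M: "norm (G x) \<le> M" for x
  proof -
    have "norm (G x) \<le> norm (F z0) + dist (F (P x)) (F z0)"
      unfolding G_def dist_norm using norm_triangle_sub by blast
    also have "dist (F (P x)) (F z0) \<le> L * dist (P x) z0"
      using lipschitz_onD[OF lip Pin] r by simp
    also have "\<dots> \<le> L * r"
      using Pin[of x] L0 by (intro mult_left_mono) (auto simp: dist_commute)
    finally show ?thesis by (simp add: M_def)
  qed
  have M0: "0 \<le> M" using M[of z0] norm_ge_zero order_trans by blast
  \<comment> \<open>The first bound yields the contraction factor 1/2, the second a displacement of
    at most \<open>r\<close>. Adding 1 keeps the denominators positive when \<open>L\<close> or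
    \<open>M\<close> vanishes.\<close>
  define \<epsilon> where "\<epsilon> = min (1 / (2 * (L + 1))) (r / (M + 1))"
  have eps: "0 < \<epsilon>" "\<epsilon> * L \<le> 1/2" "\<epsilon> * M \<le> r"
  proof -
    show "0 < \<epsilon>" using L0 M0 r by (simp add: \<epsilon>_def)
    have "\<epsilon> * L \<le> 1 / (2 * (L + 1)) * L" using L0 by (intro mult_right_mono) (auto simp: \<epsilon>_def)
    also have "\<dots> \<le> 1/2" using L0 by (simp add: field_simps)
    finally show "\<epsilon> * L \<le> 1/2" .
    have "\<epsilon> * M \<le> r / (M + 1) * M" using M0 by (intro mult_right_mono) (auto simp: \<epsilon>_def)
    also have "\<dots> \<le> r" using M0 r by (simp add: field_simps)
    finally show "\<epsilon> * M \<le> r" .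
  qed
  \<comment> \<open>Clamping time to the unit interval makes the Picard operator yield bounded
    continuous functions on the whole real line, a complete space in which Banach's theorem
    applies.\<close>
  define cl where "cl t = max 0 (min 1 t)" for t :: real
  have cl: "cl t \<in> {0..1}" "t \<in> {0..1} \<Longrightarrow> cl t = t" for t
    by (auto simp: cl_def)
  define T where "T z t = z0 + \<epsilon> *\<^sub>R integral {0..cl t} (\<lambda>s. G (apply_bcontfun z s))"
    for z :: "real \<Rightarrow>\<^sub>C 'a" and t
  have contGz: "continuous_on S (\<lambda>s. G (apply_bcontfun z s))" for z :: "real \<Rightarrow>\<^sub>C 'a" and S
    by (rule continuous_on_compose2[OF contG[of UNIV]]) auto
  have intGz: "(\<lambda>s. G (apply_bcontfun z s)) integrable_on {a..b}" for z :: "real \<Rightarrow>\<^sub>C 'a" and a b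
    by (rule integrable_continuous_real[OF contGz])
  have bound: "norm (integral {0..cl t} (\<lambda>s. G (apply_bcontfun z s))) \<le> M" for z t
  proof -
    have "norm (integral {0..cl t} (\<lambda>s. G (apply_bcontfun z s))) \<le> M * (cl t - 0)"
      using cl(1)[of t] by (intro integral_bound contGz M) auto
    also have "\<dots> \<le> M * 1" using cl(1)[of t] M0 by (intro mult_left_mono) auto
    finally show ?thesis by simp
  qed
  have Tz: "norm (T z t - z0) \<le> r" for z t
  proof -
    have "norm (T z t - z0) \<le> \<epsilon> * M" using bound eps(1) by (simp add: T_def)
    with eps(3) show ?thesis by simp
  qed
  have T_bcontfun: "T z \<in> bcontfun" for z
  proof (rule bcontfun_normI)
    have "continuous_on UNIV cl" unfolding cl_def by (intro continuous_intros)
    then show "continuous_on UNIV (T z)"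
      unfolding T_def
      by (intro continuous_intros continuous_on_compose2[OF indefinite_integral_continuous_1[OF intGz, of 0 1]])
         (use cl in auto)
    show "norm (T z t) \<le> norm z0 + r" for t
      using Tz[of z t] norm_triangle_sub[of "T z t" z0] by linarith
  qed
  have "\<exists>!z. Bcontfun (T z) = z"
  proof (intro banach_fix_type[of "1/2"] allI dist_bound)
    fix y z :: "real \<Rightarrow>\<^sub>C 'a" and t
    have "dist (T y t) (T z t) =
        \<epsilon> * norm (integral {0..cl t} (\<lambda>s. G (apply_bcontfun y s) - G (apply_bcontfun z s)))"
      using eps(1) by (simp add: T_def dist_norm integral_diff[OF intGz intGz] flip: scaleR_diff_right)
    also have "\<dots> \<le> \<epsilon> * (L * dist y z * (cl t - 0))"
    proof (intro mult_left_mono integral_bound)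
      show "norm (G (apply_bcontfun y s) - G (apply_bcontfun z s)) \<le> L * dist y z" for s
      proof -
        have "norm (G (apply_bcontfun y s) - G (apply_bcontfun z s)) \<le>
            L * dist (apply_bcontfun y s) (apply_bcontfun z s)"
          using G by (simp add: dist_norm)
        also have "\<dots> \<le> L * dist y z" by (intro mult_left_mono dist_bounded L0)
        finally show ?thesis .
      qed
    qed (use cl(1)[of t] eps(1) in \<open>auto intro!: continuous_intros contGz\<close>)
    also have "\<dots> \<le> \<epsilon> * (L * dist y z * 1)"
      using cl(1)[of t] eps(1) L0 by (intro mult_left_mono) auto
    also have "\<dots> \<le> 1/2 * dist y z"
      using mult_right_mono[OF eps(2), of "dist y z"] by (simp add: mult.assoc)
    finally show "dist (apply_bcontfun (Bcontfun (T y)) t) (apply_bcontfun (Bcontfun (T z)) t) \<le> 1/2 * dist y z"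
      by (simp add: Bcontfun_inverse T_bcontfun)
  qed simp_all
  then obtain z where "Bcontfun (T z) = z" by blast
  then have fix_z: "apply_bcontfun z = T z"
    by (metis Bcontfun_inverse T_bcontfun)
  have GF: "G (T z t) = F (T z t)" for t
    using Tz[of z t] by (simp add: G_def P_def closest_point_self dist_norm norm_minus_commute)
  show thesis
  proof (rule that[OF eps(1)])
    show "T z 0 = z0" by (simp add: T_def cl_def)
    fix t :: real assume t: "t \<in> {0..1}"
    have "((\<lambda>u. z0 + \<epsilon> *\<^sub>R integral {0..u} (\<lambda>s. G (apply_bcontfun z s))) has_vector_derivative
        0 + \<epsilon> *\<^sub>R G (apply_bcontfun z t)) (at t within {0..1})"
      by (intro has_vector_derivative_add has_vector_derivative_const
          bounded_linear.has_vector_derivative[OF bounded_linear_scaleR_right]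
          integral_has_vector_derivative contGz t)
    moreover have "T z u = z0 + \<epsilon> *\<^sub>R integral {0..u} (\<lambda>s. G (apply_bcontfun z s))"
      if "u \<in> {0..1}" for u
      using cl(2)[OF that] by (simp add: T_def)
    ultimately have "(T z has_vector_derivative 0 + \<epsilon> *\<^sub>R G (apply_bcontfun z t)) (at t within {0..1})"
      by (rule has_vector_derivative_transform[OF t, rotated])
    then show "(T z has_vector_derivative \<epsilon> *\<^sub>R F (T z t)) (at t within {0..1})"
      by (simp add: fix_z GF)
  qed
qed

text \<open>For a constant factor the Leibniz rule loses its derivative term, so the connection is
  bilinear over the reals on constant fields. The expansion serves twice: it shows joint smoothness
  in point and velocity, and it shows homogeneity of degree 2 in the velocity.\<close>

lemma christoffel_quadratic:
  assumes "affine_connection D"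
  shows "christoffel D p u u =
    (\<Sum>i\<in>Basis. \<Sum>j\<in>Basis. (u \<bullet> i) *\<^sub>R (u \<bullet> j) *\<^sub>R christoffel D p i j)"
proof -
  have add1: "D (\<lambda>_. u + v) (\<lambda>_. w) p = D (\<lambda>_. u) (\<lambda>_. w) p + D (\<lambda>_. v) (\<lambda>_. w) p"
    and add2: "D (\<lambda>_. w) (\<lambda>_. u + v) p = D (\<lambda>_. w) (\<lambda>_. u) p + D (\<lambda>_. w) (\<lambda>_. v) p"
    and scale1: "D (\<lambda>_. c *\<^sub>R u) (\<lambda>_. w) p = c *\<^sub>R D (\<lambda>_. u) (\<lambda>_. w) p"
    and scale2: "D (\<lambda>_. w) (\<lambda>_. c *\<^sub>R u) p = c *\<^sub>R D (\<lambda>_. w) (\<lambda>_. u) p" for u v w c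
    using assms unfolding affine_connection_def by (auto simp: smooth_const vderiv_def fun_eq_iff)
  have 1: "linear (\<lambda>u. christoffel D p u w)" and 2: "linear (christoffel D p w)" for w
    unfolding christoffel_def by (auto intro!: linearI add1 add2 scale1 scale2)
  have "christoffel D p u u = (\<Sum>i\<in>Basis. (u \<bullet> i) *\<^sub>R christoffel D p i u)"
    using 1 by (rule linear_apply_Basis)
  also have "\<dots> = (\<Sum>i\<in>Basis. (u \<bullet> i) *\<^sub>R (\<Sum>j\<in>Basis. (u \<bullet> j) *\<^sub>R christoffel D p i j))"
    using linear_apply_Basis[OF 2] by metis
  finally show ?thesis by (simp add: scaleR_sum_right)
qed

text \<open>This is the geodesic equation written as a first-order system for position and velocity.
  The Christoffel coefficients for fixed directions are smooth because the connection preserves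
  smoothness, and the velocity enters polynomially.\<close>

lemma smooth_geodesic_field:
  fixes D :: "('a::euclidean_space \<Rightarrow> 'a) \<Rightarrow> ('a \<Rightarrow> 'a) \<Rightarrow> ('a \<Rightarrow> 'a)"
  assumes "affine_connection D"
  shows "smooth (\<lambda>q::'a \<times> 'a. (snd q, - christoffel D (fst q) (snd q) (snd q)))"
proof -
  have "smooth (\<lambda>p. christoffel D p u v)" for u v
    using assms by (simp add: affine_connection_def christoffel_def smooth_const)
  then have "smooth (\<lambda>q::'a \<times> 'a. christoffel D (fst q) u v)" for u v
    by (rule smooth_compose_linear[OF bounded_linear_fst])
  moreover have snd: "smooth (snd :: 'a \<times> 'a \<Rightarrow> 'a)"
    by (rule smooth_linear) (rule linear_snd)
  ultimately have "smooth (\<lambda>q::'a \<times> 'a. christoffel D (fst q) (snd q) (snd q))"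
    unfolding christoffel_quadratic[OF assms, of _ "snd _"]
    by (intro smooth_sum smooth_scaleR smooth_inner smooth_const finite_Basis) auto
  then have "smooth (\<lambda>q::'a \<times> 'a. (snd q, 0) + (0, - christoffel D (fst q) (snd q) (snd q)))"
    by (intro smooth_add smooth_bounded_linear[OF _ snd]
        smooth_bounded_linear[where L = "\<lambda>x. (0, - x)"]
        bounded_linear_Pair bounded_linear_ident bounded_linear_zero bounded_linear_minus)
  then show ?thesis by simp
qed

text \<open>The existence result covers all of the unit interval only for the field scaled by
  \<open>\<epsilon>\<close>. By quadratic homogeneity a solution of the scaled system is still a
  geodesic, with initial velocity \<open>\<epsilon> *\<^sub>R v\<close> instead of \<open>v\<close>;
  only the direction of that vector matters later.\<close>

lemma geodesic_exists:
  fixes D :: "('a::euclidean_space \<Rightarrow> 'a) \<Rightarrow> ('a \<Rightarrow> 'a) \<Rightarrow> ('a \<Rightarrow> 'a)"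
  assumes "affine_connection D"
  obtains \<gamma> \<gamma>' \<gamma>'' \<epsilon> where "0 < \<epsilon>" "\<gamma> 0 = p" "\<gamma>' 0 = \<epsilon> *\<^sub>R v" "geodesic D \<gamma>"
    "\<And>t. t \<in> {0..1} \<Longrightarrow> (\<gamma> has_vector_derivative \<gamma>' t) (at t within {0..1})"
    "\<And>t. t \<in> {0..1} \<Longrightarrow> (\<gamma>' has_vector_derivative \<gamma>'' t) (at t within {0..1})"
proof -
  let ?F = "\<lambda>q::'a \<times> 'a. (snd q, - christoffel D (fst q) (snd q) (snd q))"
  obtain L where "L-lipschitz_on (cball (p, v) 1) ?F"
    using smooth_imp_lipschitz_on_cball[OF smooth_geodesic_field[OF assms]] by blast
  then obtain \<epsilon> z where \<epsilon>: "0 < \<epsilon>" and z0: "z 0 = (p, v)"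
    and z: "\<And>t. t \<in> {0..1} \<Longrightarrow> (z has_vector_derivative \<epsilon> *\<^sub>R ?F (z t)) (at t within {0..1})"
    using integral_curve_exists[of L "(p, v)" 1 ?F] by auto
  define \<gamma> where "\<gamma> t = fst (z t)" for t
  define \<gamma>' where "\<gamma>' t = \<epsilon> *\<^sub>R snd (z t)" for t
  \<comment> \<open>One factor \<open>\<epsilon>\<close> comes from the definition of
    \<open>\<gamma>'\<close>, the other from the scaled field. Together they match the two velocity
    arguments of \<open>christoffel\<close>.\<close>
  define \<gamma>'' where "\<gamma>'' t = - \<epsilon> *\<^sub>R \<epsilon> *\<^sub>R christoffel D (fst (z t)) (snd (z t)) (snd (z t))" for t
  have 1: "(\<gamma> has_vector_derivative \<gamma>' t) (at t within {0..1})" if "t \<in> {0..1}" for t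
    using bounded_linear.has_vector_derivative[OF bounded_linear_fst z[OF that]]
    by (simp add: \<gamma>_def[abs_def] \<gamma>'_def)
  have 2: "(\<gamma>' has_vector_derivative \<gamma>'' t) (at t within {0..1})" if "t \<in> {0..1}" for t
    using bounded_linear.has_vector_derivative[OF bounded_linear_compose[OF bounded_linear_scaleR_right
          bounded_linear_snd] z[OF that], of \<epsilon>]
    by (simp add: \<gamma>'_def[abs_def] \<gamma>''_def)
  have "\<gamma>'' t + christoffel D (\<gamma> t) (\<gamma>' t) (\<gamma>' t) = 0" for t
    unfolding christoffel_quadratic[OF assms, of _ "\<gamma>' t"]
    by (simp add: \<gamma>''_def \<gamma>_def \<gamma>'_def christoffel_quadratic[OF assms, of _ "snd (z t)"]
        scaleR_sum_right sum_negf mult_ac)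
  with 1 2 have "geodesic D \<gamma>" unfolding geodesic_def by blast
  with \<epsilon> 1 2 show thesis by (intro that[of \<epsilon> \<gamma> \<gamma>']) (auto simp: \<gamma>_def \<gamma>'_def z0)
qed

section \<open>Convexity on the unit interval and second derivatives\<close>

text \<open>If \<open>l\<close> were negative, \<open>\<phi>'\<close> would be negative just to the
  right of 0 and \<open>\<phi>\<close> would drop below \<open>\<phi> 0\<close> at some
  \<open>s\<close>. By convexity \<open>\<phi>\<close> lies below the descending chord from 0 to
  \<open>s\<close>, whereas its vanishing slope at 0 puts it above that chord near 0.\<close>

lemma convex_on_min_at_0_second_derivative_nonneg:
  fixes \<phi> :: "real \<Rightarrow> real"
  assumes conv: "convex_on {0..1} \<phi>"
    and d1: "\<And>t. t \<in> {0..1} \<Longrightarrow> (\<phi> has_real_derivative \<phi>' t) (at t within {0..1})"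
    and d2: "(\<phi>' has_real_derivative l) (at 0 within {0..1})"
    and "\<phi>' 0 = 0"
  shows "0 \<le> l"
proof (rule ccontr)
  assume "\<not> 0 \<le> l"
  then obtain d where d: "0 < d" "\<And>h. 0 < h \<Longrightarrow> h \<in> {0..1} \<Longrightarrow> h < d \<Longrightarrow> \<phi>' h < 0"
    using has_real_derivative_neg_dec_right[OF d2] \<open>\<phi>' 0 = 0\<close> by auto
  define s where "s = min 1 d / 2"
  have s: "0 < s" "s < 1" "s < d" using d(1) by (auto simp: s_def)
  have "\<exists>x\<in>{0<..<s}. \<phi> s - \<phi> 0 = \<phi>' x * (s - 0)"
  proof (intro mvt_simple s)
    fix x assume "0 \<le> x" "x \<le> s"
    then show "(\<phi> has_derivative (*) (\<phi>' x)) (at x within {0..s})"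
      using d1[of x] s unfolding has_field_derivative_def
      by (auto intro: has_derivative_subset)
  qed
  then obtain x where "0 < x" "x < s" and x: "\<phi> s - \<phi> 0 = \<phi>' x * s" by auto
  then have "\<phi>' x < 0" using d s by auto
  then have neg: "\<phi> s < \<phi> 0" using mult_neg_pos[of "\<phi>' x" s] x s by linarith
  define k where "k = (\<phi> s - \<phi> 0) / s"
  have k: "k < 0" using neg s by (simp add: k_def field_simps)
  \<comment> \<open>The derivative at 0 is \<open>- k > 0\<close>, so subtracting the chord leaves a
    function that exceeds its initial value just to the right of 0.\<close>
  have "((\<lambda>t. \<phi> t - k * t) has_real_derivative \<phi>' 0 - k * 1) (at 0 within {0..1})"
    by (intro derivative_intros d1) auto
  then obtain e where e: "0 < e" "\<And>h. 0 < h \<Longrightarrow> h \<in> {0..1} \<Longrightarrow> h < e \<Longrightarrow> \<phi> 0 < \<phi> h - k * h"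
    using has_real_derivative_pos_inc_right[of "\<lambda>t. \<phi> t - k * t" "\<phi>' 0 - k * 1" 0 "{0..1}"] k \<open>\<phi>' 0 = 0\<close>
    by auto
  define h where "h = min s e / 2"
  have h: "0 < h" "h < s" "h < e" using e s by (auto simp: h_def)
  have "\<phi> ((1 - h / s) *\<^sub>R 0 + (h / s) *\<^sub>R s) \<le> (1 - h / s) * \<phi> 0 + h / s * \<phi> s"
    using s h by (intro convex_onD[OF conv]) auto
  then have "\<phi> h \<le> \<phi> 0 + k * h" using s by (simp add: k_def field_simps)
  with e(2)[of h] h s show False by auto
qed

text \<open>The derivatives are one-sided at the end points, where they are never evaluated: the
  mean value theorem turns the slopes of the chords on either side of \<open>z\<close> into values
  of \<open>\<phi>'\<close> at interior points \<open>a < b\<close>, and a second application, to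
  \<open>\<phi>'\<close>, orders these values.\<close>

lemma convex_on_unit_interval_second_derivative:
  fixes \<phi> :: "real \<Rightarrow> real"
  assumes d1: "\<And>t. t \<in> {0..1} \<Longrightarrow> (\<phi> has_real_derivative \<phi>' t) (at t within {0..1})"
    and d2: "\<And>t. t \<in> {0..1} \<Longrightarrow> (\<phi>' has_real_derivative \<phi>'' t) (at t within {0..1})"
    and nonneg: "\<And>t. t \<in> {0..1} \<Longrightarrow> 0 \<le> \<phi>'' t"
  shows "convex_on {0..1} \<phi>"
proof (rule convex_on_linorderI)
  have mvt: "\<exists>\<xi>\<in>{x<..<y}. h y - h x = h' \<xi> * (y - x)"
    if "x < y" "0 \<le> x" "y \<le> 1"
      and "\<And>t. t \<in> {0..1} \<Longrightarrow> (h has_real_derivative h' t) (at t within {0..1})"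
    for x y :: real and h h'
  proof (intro mvt_simple that)
    fix t assume "x \<le> t" "t \<le> y"
    then show "(h has_derivative (*) (h' t)) (at t within {x..y})"
      using that(2,3) that(4)[of t] unfolding has_field_derivative_def
      by (auto intro: has_derivative_subset)
  qed
  fix t x y :: real
  assume t: "0 < t" "t < 1" and xy: "x \<in> {0..1}" "y \<in> {0..1}" "x < y"
  define z where "z = (1 - t) * x + t * y"
  have zx: "z - x = t * (y - x)" and zy: "y - z = (1 - t) * (y - x)"
    by (simp_all add: z_def algebra_simps)
  have "0 < z - x" "0 < y - z"
    unfolding zx zy using t xy by simp_all
  then have "x < z" "z < y" by simp_all
  then obtain a b where a: "x < a" "a < z" "\<phi> z - \<phi> x = \<phi>' a * (z - x)"
    and b: "z < b" "b < y" "\<phi> y - \<phi> z = \<phi>' b * (y - z)"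
    using mvt[OF _ _ _ d1, of x z] mvt[OF _ _ _ d1, of z y] xy by fastforce
  have "a < b" "0 \<le> a" "b \<le> 1" using a b xy by auto
  then obtain c where c: "a < c" "c < b" "\<phi>' b - \<phi>' a = \<phi>'' c * (b - a)"
    using mvt[OF _ _ _ d2, of a b] by fastforce
  have "0 \<le> \<phi>'' c" using c a b xy by (intro nonneg) auto
  then have "0 \<le> \<phi>' b - \<phi>' a" using c by simp
  \<comment> \<open>The factor clears denominators: by \<open>zx\<close> and \<open>zy\<close> it
    equals both \<open>t * (y - z)\<close> and \<open>(1 - t) * (z - x)\<close>.\<close>
  then have "0 \<le> (\<phi>' b - \<phi>' a) * ((1 - t) * (t * (y - x)))"
    using t xy by (intro mult_nonneg_nonneg) auto
  also have "\<dots> = t * (\<phi> y - \<phi> z) - (1 - t) * (\<phi> z - \<phi> x)"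
    unfolding a b zx zy by (simp add: algebra_simps)
  finally have "\<phi> z \<le> (1 - t) * \<phi> x + t * \<phi> y" by (simp add: algebra_simps)
  then show "\<phi> ((1 - t) *\<^sub>R x + t *\<^sub>R y) \<le> (1 - t) * \<phi> x + t * \<phi> y"
    by (simp add: z_def)
qed simp

section \<open>Derivatives of the quadratic function along curves\<close>

lemma inner_symmetric_matrix:
  fixes A :: "real^'n^'n"
  assumes "transpose A = A"
  shows "x \<bullet> (A *v y) = (A *v x) \<bullet> y"
  by (metis assms dot_lmul_matrix vector_transpose_matrix)

text \<open>Symmetry of \<open>A\<close> merges the two terms of the product rule, so the gradient
  of \<open>f\<close> is \<open>A *v x + b\<close>. In the second derivative the acceleration meets
  only this gradient, which is how the connection enters.\<close>

lemma quadratic_derivatives_along_curve: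
  fixes A :: "real^'n^'n"
  assumes A: "transpose A = A"
    and f: "\<And>x. f x = 1/2 * (x \<bullet> (A *v x)) + b \<bullet> x + c"
    and d1: "(\<gamma> has_vector_derivative \<gamma>' t) (at t within S)"
    and d2: "(\<gamma>' has_vector_derivative \<gamma>'') (at t within S)"
  shows "((f \<circ> \<gamma>) has_real_derivative (A *v \<gamma> t + b) \<bullet> \<gamma>' t) (at t within S)"
    and "((\<lambda>s. (A *v \<gamma> s + b) \<bullet> \<gamma>' s) has_real_derivative
      (A *v \<gamma>' t) \<bullet> \<gamma>' t + (A *v \<gamma> t + b) \<bullet> \<gamma>'') (at t within S)"
proof -
  have Ad: "((\<lambda>s. A *v \<gamma> s) has_vector_derivative A *v \<gamma>' t) (at t within S)"
    using d1 by (rule bounded_linear.has_vector_derivative[OF matrix_vector_mul_bounded_linear])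
  have "((\<lambda>s. 1/2 * (\<gamma> s \<bullet> (A *v \<gamma> s)) + b \<bullet> \<gamma> s + c) has_vector_derivative
      1/2 * (\<gamma> t \<bullet> (A *v \<gamma>' t) + \<gamma>' t \<bullet> (A *v \<gamma> t)) + b \<bullet> \<gamma>' t + 0) (at t within S)"
    by (intro has_vector_derivative_add has_vector_derivative_const
        bounded_linear.has_vector_derivative[OF bounded_linear_mult_right]
        bounded_linear.has_vector_derivative[OF bounded_linear_inner_right]
        bounded_bilinear.has_vector_derivative[OF bounded_bilinear_inner] d1 Ad)
  moreover have "f \<circ> \<gamma> = (\<lambda>s. 1/2 * (\<gamma> s \<bullet> (A *v \<gamma> s)) + b \<bullet> \<gamma> s + c)"
    by (simp add: fun_eq_iff f)
  ultimately show "((f \<circ> \<gamma>) has_real_derivative (A *v \<gamma> t + b) \<bullet> \<gamma>' t) (at t within S)"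
    using inner_symmetric_matrix[OF A, of "\<gamma> t" "\<gamma>' t"] inner_commute[of "\<gamma>' t" "A *v \<gamma> t"]
    by (simp add: has_real_derivative_iff_has_vector_derivative inner_add_left)
  have "((\<lambda>s. (A *v \<gamma> s + b) \<bullet> \<gamma>' s) has_vector_derivative
      (A *v \<gamma> t + b) \<bullet> \<gamma>'' + (A *v \<gamma>' t + 0) \<bullet> \<gamma>' t) (at t within S)"
    by (intro has_vector_derivative_add has_vector_derivative_const
        bounded_bilinear.has_vector_derivative[OF bounded_bilinear_inner] d2 Ad)
  then show "((\<lambda>s. (A *v \<gamma> s + b) \<bullet> \<gamma>' s) has_real_derivative
      (A *v \<gamma>' t) \<bullet> \<gamma>' t + (A *v \<gamma> t + b) \<bullet> \<gamma>'') (at t within S)"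
    by (simp add: has_real_derivative_iff_has_vector_derivative add.commute)
qed

section \<open>The sheared Euclidean metric and its Levi-Civita connection\<close>

lemma vderiv_add:
  assumes "smooth Y" "smooth Z"
  shows "vderiv X (\<lambda>p. Y p + Z p) p = vderiv X Y p + vderiv X Z p"
  unfolding vderiv_def
  using frechet_derivative_at[OF has_derivative_add[OF smooth_has_derivative[OF assms(1)]
        smooth_has_derivative[OF assms(2)]], of p] by metis

lemma vderiv_scaleR:
  assumes "smooth h" "smooth Y"
  shows "vderiv X (\<lambda>p. h p *\<^sub>R Y p) p = vderiv X h p *\<^sub>R Y p + h p *\<^sub>R vderiv X Y p"
  unfolding vderiv_def
  using frechet_derivative_at[OF has_derivative_scaleR[OF smooth_has_derivative[OF assms(1)]
        smooth_has_derivative[OF assms(2)]], of p] by (metis add.commute)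

text \<open>Pullbacks under \<open>x \<mapsto> x + (\<onehalf> x\<^sup>T A x) w\<close>, a diffeomorphism with inverse
  \<open>y \<mapsto> y - (\<onehalf> y\<^sup>T A y) w\<close> when \<open>A w = 0\<close>.\<close>

definition shear_metric :: "real^'n^'n \<Rightarrow> real^'n \<Rightarrow> real^'n \<Rightarrow> real^'n \<Rightarrow> real^'n \<Rightarrow> real" where
  "shear_metric A w p u v = (u + ((A *v p) \<bullet> u) *\<^sub>R w) \<bullet> (v + ((A *v p) \<bullet> v) *\<^sub>R w)"

definition shear_connection ::
    "real^'n^'n \<Rightarrow> real^'n \<Rightarrow> (real^'n \<Rightarrow> real^'n) \<Rightarrow> (real^'n \<Rightarrow> real^'n) \<Rightarrow> real^'n \<Rightarrow> real^'n" where
  "shear_connection A w X Y p = vderiv X Y p + ((A *v X p) \<bullet> Y p) *\<^sub>R w"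

lemma christoffel_shear_connection:
  "christoffel (shear_connection A w) p u v = ((A *v u) \<bullet> v) *\<^sub>R w"
  by (simp add: christoffel_def shear_connection_def vderiv_def)

text \<open>The directional derivative \<open>vderiv\<close> is the flat connection. The added term
  is a smooth tensor, bilinear over functions, which preserves all the axioms.\<close>

lemma affine_connection_shear_connection:
  fixes A :: "real^'n^'n"
  shows "affine_connection (shear_connection A w)"
  unfolding affine_connection_def
proof (intro conjI allI impI)
  fix X Y :: "real^'n \<Rightarrow> real^'n"
  assume "smooth X" "smooth Y"
  then show "smooth (shear_connection A w X Y)"
    unfolding shear_connection_def[abs_def] vderiv_def
    by (intro smooth_add smooth_frechet_derivative_apply smooth_scaleR smooth_inner smooth_const
        smooth_bounded_linear[OF matrix_vector_mul_bounded_linear])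
next
  fix X Y Z :: "real^'n \<Rightarrow> real^'n"
  assume "smooth X" "smooth Y" "smooth Z"
  then show "shear_connection A w (\<lambda>p. X p + Y p) Z =
      (\<lambda>p. shear_connection A w X Z p + shear_connection A w Y Z p)"
    by (auto simp: shear_connection_def vderiv_def linear_add[OF has_derivative_linear[OF smooth_has_derivative]]
        matrix_vector_right_distrib inner_add_left scaleR_add_left)
next
  fix h :: "real^'n \<Rightarrow> real" and X Z :: "real^'n \<Rightarrow> real^'n"
  assume "smooth h" "smooth X" "smooth Z"
  then show "shear_connection A w (\<lambda>p. h p *\<^sub>R X p) Z = (\<lambda>p. h p *\<^sub>R shear_connection A w X Z p)"
    by (auto simp: shear_connection_def vderiv_def linear_scale[OF has_derivative_linear[OF smooth_has_derivative]]
        matrix_vector_mult_scaleR scaleR_add_right)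
next
  fix X Y Z :: "real^'n \<Rightarrow> real^'n"
  assume "smooth X" "smooth Y" "smooth Z"
  then show "shear_connection A w X (\<lambda>p. Y p + Z p) =
      (\<lambda>p. shear_connection A w X Y p + shear_connection A w X Z p)"
    by (auto simp: shear_connection_def vderiv_add inner_add_right scaleR_add_left)
next
  fix h :: "real^'n \<Rightarrow> real" and X Y :: "real^'n \<Rightarrow> real^'n"
  assume "smooth h" "smooth X" "smooth Y"
  then show "shear_connection A w X (\<lambda>p. h p *\<^sub>R Y p) =
      (\<lambda>p. vderiv X h p *\<^sub>R Y p + h p *\<^sub>R shear_connection A w X Y p)"
    by (auto simp: shear_connection_def vderiv_scaleR scaleR_add_right)
qed

text \<open>The added tensor is symmetric because \<open>A\<close> is, so it cancels and leaves the
  torsion of the flat connection, which is zero.\<close>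

lemma torsion_free_shear_connection:
  assumes "transpose A = A"
  shows "torsion_free (shear_connection A w)"
proof -
  have "(A *v u) \<bullet> v = (A *v v) \<bullet> u" for u v
    using inner_symmetric_matrix[OF assms, of v u] by (simp add: inner_commute)
  then show ?thesis
    by (auto simp: torsion_free_def shear_connection_def lie_bracket_def)
qed

text \<open>Nondegeneracy follows by testing \<open>u\<close> against itself, which makes its image
  under the differential of the shear vanish. Pairing that image with \<open>A *v p\<close>, which
  is orthogonal to \<open>w\<close>, gives \<open>(A *v p) \<bullet> u = 0\<close> and then
  \<open>u = 0\<close>.\<close>

lemma pseudo_riemannian_metric_shear_metric:
  assumes A: "transpose A = A" and w: "A *v w = 0"
  shows "pseudo_riemannian_metric (shear_metric A w)"
  unfolding pseudo_riemannian_metric_def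
proof (intro conjI allI impI)
  show "bilinear (shear_metric A w p)" for p
    unfolding bilinear_def shear_metric_def by (auto intro!: linearI simp: algebra_simps)
  show "shear_metric A w p u v = shear_metric A w p v u" for p u v
    by (simp add: shear_metric_def inner_commute)
  show "smooth (\<lambda>p. shear_metric A w p u v)" for u v
    unfolding shear_metric_def
    by (intro smooth_add smooth_scaleR smooth_inner smooth_const smooth_linear matrix_vector_mul_linear)
  fix p u
  assume "\<forall>v. shear_metric A w p u v = 0"
  then have u: "u + ((A *v p) \<bullet> u) *\<^sub>R w = 0"
    using inner_eq_zero_iff unfolding shear_metric_def by blast
  have "(A *v p) \<bullet> w = 0"
    using inner_symmetric_matrix[OF A, of p w] w by simp
  then have "(A *v p) \<bullet> u = 0"
    using arg_cong[OF u, of "(\<bullet>) (A *v p)"] by (simp add: inner_add_right)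
  with u show "u = 0" by simp
qed

lemma levi_civita_connection_shear:
  fixes A :: "real^'n^'n"
  assumes A: "transpose A = A" and w: "A *v w = 0"
  shows "levi_civita_connection (shear_metric A w) (shear_connection A w)"
  unfolding levi_civita_connection_def
proof (intro conjI allI impI affine_connection_shear_connection torsion_free_shear_connection A)
  fix X Y Z :: "real^'n \<Rightarrow> real^'n" and p
  assume smooth: "smooth X" "smooth Y" "smooth Z"
  \<comment> \<open>This is the differential of the shear at \<open>q\<close>; the metric is the
    Euclidean inner product of images under it.\<close>
  let ?E = "\<lambda>q v. v + ((A *v q) \<bullet> v) *\<^sub>R w"
  have Aw: "(A *v p) \<bullet> w = 0"
    using inner_symmetric_matrix[OF A, of p w] w by simp
  have E: "((\<lambda>q. ?E q (V q)) has_derivative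
      (\<lambda>v. frechet_derivative V (at p) v +
        ((A *v p) \<bullet> frechet_derivative V (at p) v + (A *v v) \<bullet> V p) *\<^sub>R w)) (at p)"
    if "smooth V" for V
    by (intro has_derivative_add smooth_has_derivative that has_derivative_inner has_derivative_scaleR_left
        bounded_linear_imp_has_derivative matrix_vector_mul_bounded_linear)
  \<comment> \<open>Because \<open>(A *v p) \<bullet> w = 0\<close>, the differential carries the
    covariant derivative of \<open>V\<close> to the ordinary derivative of the image field computed
    in \<open>E\<close>. Compatibility with the metric is then the product rule for the inner
    product.\<close>
  have D: "?E p (shear_connection A w X V p) = frechet_derivative V (at p) (X p) +
        ((A *v p) \<bullet> frechet_derivative V (at p) (X p) + (A *v X p) \<bullet> V p) *\<^sub>R w" for V
    by (simp add: shear_connection_def vderiv_def inner_add_right Aw algebra_simps)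
  show "vderiv X (\<lambda>q. shear_metric A w q (Y q) (Z q)) p =
      shear_metric A w p (shear_connection A w X Y p) (Z p) +
      shear_metric A w p (Y p) (shear_connection A w X Z p)"
    unfolding shear_metric_def vderiv_def D
      frechet_derivative_at[OF has_derivative_inner[OF E[OF smooth(2)] E[OF smooth(3)]], symmetric]
    by (simp add: add.commute)
qed

section \<open>Geodesic convexity of the quadratic function\<close>

text \<open>Along a geodesic the acceleration is a multiple of \<open>w\<close>, on which
  \<open>A *v \<gamma> t\<close> vanishes, so the second derivative of \<open>f\<close> is
  \<open>(1 - b \<bullet> w)\<close> times the quadratic form of the velocity. The sign hypothesis
  is stated so as to cover both choices of \<open>w\<close>.\<close>

lemma g_convex_shear_connection:
  fixes A :: "real^'n^'n"
  assumes A: "transpose A = A" and w: "A *v w = 0"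
    and f: "\<And>x. f x = 1/2 * (x \<bullet> (A *v x)) + b \<bullet> x + c"
    and nonneg: "\<And>x. 0 \<le> (1 - b \<bullet> w) * (x \<bullet> (A *v x))"
  shows "g_convex (shear_connection A w) f"
  unfolding g_convex_def
proof (intro allI impI)
  fix \<gamma>
  assume "geodesic (shear_connection A w) \<gamma>"
  then obtain \<gamma>' \<gamma>'' where
    d1: "\<And>t. t \<in> {0..1} \<Longrightarrow> (\<gamma> has_vector_derivative \<gamma>' t) (at t within {0..1})" and
    d2: "\<And>t. t \<in> {0..1} \<Longrightarrow> (\<gamma>' has_vector_derivative \<gamma>'' t) (at t within {0..1})" and
    geo: "\<And>t. t \<in> {0..1} \<Longrightarrow> \<gamma>'' t + ((A *v \<gamma>' t) \<bullet> \<gamma>' t) *\<^sub>R w = 0"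
    unfolding geodesic_def christoffel_shear_connection by metis
  note d = quadratic_derivatives_along_curve[OF A f d1 d2]
  show "convex_on {0..1} (f \<circ> \<gamma>)"
  proof (rule convex_on_unit_interval_second_derivative[OF d])
    fix t :: real
    assume "t \<in> {0..1}"
    then have "\<gamma>'' t = - ((A *v \<gamma>' t) \<bullet> \<gamma>' t) *\<^sub>R w"
      using geo[of t] by (simp add: eq_neg_iff_add_eq_0)
    moreover have "(A *v \<gamma> t) \<bullet> w = 0"
      using inner_symmetric_matrix[OF A, of "\<gamma> t" w] w by simp
    ultimately have "(A *v \<gamma>' t) \<bullet> \<gamma>' t + (A *v \<gamma> t + b) \<bullet> \<gamma>'' t =
        (1 - b \<bullet> w) * (\<gamma>' t \<bullet> (A *v \<gamma>' t))"
      by (simp add: inner_add_left inner_commute algebra_simps)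
    then show "0 \<le> (A *v \<gamma>' t) \<bullet> \<gamma>' t + (A *v \<gamma> t + b) \<bullet> \<gamma>'' t"
      using nonneg by simp
  qed
qed

text \<open>At a critical point the gradient annihilates the acceleration, whatever the connection.
  A geodesic leaving \<open>p\<close> in direction \<open>v\<close> thus has second derivative
  \<open>\<epsilon>\<close> squared times \<open>v \<bullet> (A *v v)\<close> at time 0, and the
  first derivative there is 0.\<close>

lemma g_convex_critical_point_imp_pos_semidef:
  fixes A :: "real^'n^'n"
  assumes A: "transpose A = A"
    and f: "\<And>x. f x = 1/2 * (x \<bullet> (A *v x)) + b \<bullet> x + c"
    and D: "affine_connection D" and conv: "g_convex D f"
    and crit: "A *v p + b = 0"
  shows "pos_semidef A"
  unfolding pos_semidef_def
proof
  fix v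
  obtain \<gamma> \<gamma>' \<gamma>'' \<epsilon> where \<epsilon>: "0 < \<epsilon>" and init: "\<gamma> 0 = p" "\<gamma>' 0 = \<epsilon> *\<^sub>R v" and geo: "geodesic D \<gamma>"
    and d1: "\<And>t. t \<in> {0..1} \<Longrightarrow> (\<gamma> has_vector_derivative \<gamma>' t) (at t within {0..1})"
    and d2: "\<And>t. t \<in> {0..1} \<Longrightarrow> (\<gamma>' has_vector_derivative \<gamma>'' t) (at t within {0..1})"
    by (rule geodesic_exists[OF D, of p v]) blast
  note d = quadratic_derivatives_along_curve[OF A f d1 d2]
  have "0 \<le> (A *v \<gamma>' 0) \<bullet> \<gamma>' 0 + (A *v \<gamma> 0 + b) \<bullet> \<gamma>'' 0"
  proof (rule convex_on_min_at_0_second_derivative_nonneg[OF _ d(1) d(2)])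
    show "convex_on {0..1} (f \<circ> \<gamma>)" using conv geo by (simp add: g_convex_def)
  qed (use crit in \<open>auto simp: init\<close>)
  then have "0 \<le> \<epsilon> * (\<epsilon> * ((A *v v) \<bullet> v))"
    using crit by (simp add: init matrix_vector_mult_scaleR)
  with \<epsilon> show "0 \<le> v \<bullet> (A *v v)"
    by (simp add: zero_le_mult_iff inner_commute)
qed

section \<open>The rank condition and kernel vectors\<close>

text \<open>Augmenting inserts \<open>b\<close> into the set of columns, and this raises the
  dimension of the span exactly when \<open>b\<close> lies outside the column space, which is the
  range of \<open>A\<close>.\<close>

lemma rank_augmented_gt_iff:
  fixes A :: "real^'n^'m"
  shows "rank A < rank (augmented A b) \<longleftrightarrow> b \<notin> range ((*v) A)"
proof -
  have "column (Inl k) (augmented A b) = column k A" "column (Inr u) (augmented A b) = b" for k u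
    by (simp_all add: column_def augmented_def vec_eq_iff)
  moreover have columns_range: "columns B = range (\<lambda>i. column i B)" for B :: "real^'k^'m"
    by (auto simp: columns_def)
  ultimately have cols: "columns (augmented A b) = insert b (columns A)"
    unfolding columns_range by (simp add: UNIV_sum UNIV_unit image_Un image_image)
  have "span (columns A) = range ((*v) A)"
  proof
    show "span (columns A) \<subseteq> range ((*v) A)"
      by (intro span_minimal linear_subspace_image matrix_vector_mul_linear subspace_UNIV)
         (auto simp: columns_image_basis)
    show "range ((*v) A) \<subseteq> span (columns A)"
      using matrix_vector_mult_in_columnspace by blast
  qed
  then show ?thesis
    by (simp add: column_rank_def cols dim_insert)
qed

text \<open>For symmetric \<open>A\<close>, vectors orthogonal to the range lie in the kernel. The
  component \<open>z\<close> of \<open>b\<close> orthogonal to the range is nonzero, and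
  \<open>b \<bullet> z = z \<bullet> z\<close> dictates the normalization.\<close>

lemma kernel_vector_if_not_in_range:
  fixes A :: "real^'n^'n"
  assumes A: "transpose A = A" and b: "b \<notin> range ((*v) A)"
  obtains w where "A *v w = 0" "b \<bullet> w = 1"
proof -
  have span: "span (range ((*v) A)) = range ((*v) A)"
    by (simp add: span_eq_iff linear_subspace_image subspace_UNIV)
  obtain y z where y: "y \<in> range ((*v) A)" and z: "\<And>x. x \<in> range ((*v) A) \<Longrightarrow> orthogonal z x"
    and byz: "b = y + z"
    using orthogonal_subspace_decomp_exists[of "range ((*v) A)" b] unfolding span by metis
  have "(A *v z) \<bullet> x = 0" for x
    using z[of "A *v x"] inner_symmetric_matrix[OF A, of z x] by (simp add: orthogonal_def)
  then have Az: "A *v z = 0" using inner_eq_zero_iff by blast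
  have "z \<noteq> 0" using b byz y by auto
  moreover have "b \<bullet> z = z \<bullet> z"
    using z[OF y] by (simp add: byz orthogonal_def inner_add_left inner_commute[of y])
  ultimately show thesis
    by (intro that[of "z /\<^sub>R (z \<bullet> z)"]) (simp_all add: Az matrix_vector_mult_scaleR)
qed

theorem theorem6p5:
  fixes A :: "real^'n^'n" and b :: "real^'n" and c :: real and f :: "real^'n \<Rightarrow> real"
  assumes "transpose A = A"
    and "\<And>x. f x = 1/2 * (x \<bullet> (A *v x)) + b \<bullet> x + c"
  shows "((\<exists>D. affine_connection D \<and> torsion_free D \<and> g_convex D f)
           \<longleftrightarrow> (\<exists>g D. pseudo_riemannian_metric g \<and> levi_civita_connection g D \<and> g_convex D f))
       \<and> ((\<exists>g D. pseudo_riemannian_metric g \<and> levi_civita_connection g D \<and> g_convex D f)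
           \<longleftrightarrow> (pos_semidef A \<or> rank (augmented A b) > rank A))"
    (is "(?a \<longleftrightarrow> ?b) \<and> (?b \<longleftrightarrow> ?c)")
proof -
  have "?b \<Longrightarrow> ?a" by (auto simp: levi_civita_connection_def)
  moreover have "?c" if ?a
  proof (rule disjCI)
    assume "\<not> rank A < rank (augmented A b)"
    then obtain x where "b = A *v x" by (auto simp: rank_augmented_gt_iff)
    then have "A *v (- x) + b = 0" using matrix_vector_mult_scaleR[of A "-1" x] by simp
    with \<open>?a\<close> g_convex_critical_point_imp_pos_semidef[OF assms] show "pos_semidef A" by blast
  qed
  moreover have "?b" if ?c
  proof -
    \<comment> \<open>The factor \<open>1 - b \<bullet> w\<close> is 1 for \<open>w = 0\<close>,
      leaving the semidefinite form, and 0 for a kernel vector with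
      \<open>b \<bullet> w = 1\<close>, where the sign of the form is irrelevant.\<close>
    obtain w where w: "A *v w = 0" and nonneg: "\<And>x. 0 \<le> (1 - b \<bullet> w) * (x \<bullet> (A *v x))"
    proof (cases "pos_semidef A")
      case True
      then show thesis by (intro that[of 0]) (auto simp: pos_semidef_def)
    next
      case False
      with \<open>?c\<close> have "b \<notin> range ((*v) A)" by (simp add: rank_augmented_gt_iff)
      then obtain w where "A *v w = 0" "b \<bullet> w = 1"
        by (rule kernel_vector_if_not_in_range[OF assms(1)])
      then show thesis by (intro that[of w]) auto
    qed
    show ?b
      using pseudo_riemannian_metric_shear_metric[OF assms(1) w] levi_civita_connection_shear[OF assms(1) w]
        g_convex_shear_connection[OF assms(1) w assms(2) nonneg] by blast
  qed
  ultimately show ?thesis by blast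
qed

end
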